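(* Let $\mathcal{N}$ be a nonempty finite or countable set and let $\Gamma(t)=(\gamma_{k,l}(t))_{(k,l)\in\mathcal{N}\times\mathcal{N}}$, $t\in\mathbb{N}$, be row-stochastic matrices. Consider the system $x_k(t+1)=\sum_{l\in\mathcal{N}}\gamma_{k,l}(t)x_l(t)$, $k\in\mathcal{N}$, $t\in\mathbb{N}$, with communication graphs $\mathcal{A}(t)$, and let $T$ be a positive integer. Assume that the sequence $(\mathcal{A}(t))_{t\in\mathbb{N}}$ is $T$-sequentially connected, and let $(t_p)_{p\in\mathbb{N}}$ be a corresponding strictly increasing integer sequence, i.e. $\limsup_{p\to+\infty}(t_{p+1}-t_p)\le T$ and, for each $p\in\mathbb{N}$, the graphs $\mathcal{A}(t_p),\dots,\mathcal{A}(t_{p+1}-1)$ are sequentially connected. For each $p$ let $\mathcal{N}_{p,s}$, $s=0,\dots,t_{p+1}-t_p$, be corresponding sets, i.e. $\mathcal{N}_{p,0}$ is a singleton, $\mathcal{N}_{p,s+1}\subseteq\mathcal{N}_{p,s}\cup\mathrm{Neighbors}(\mathcal{N}_{p,s},\mathcal{A}(t_p+s))$ for $0\le s<t_{p+1}-t_p$, and $\mathcal{N}_{p,t_{p+1}-t_p}=\mathcal{N}$. Let $$\mathcal{T}=\{(p,t):p\in\mathbb{N},\ t\in\{t_p,\dots,t_{p+1}-1\}\}.$$ Assume there is a map $\alpha:\mathcal{T}\to[0,1]$ such that for every $(p,t)\in\mathcal{T}$ and every $k\in\mathcal{N}$, $$k\in\mathcal{N}_{p,t-t_p+1}\ \Longrightarrow\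 \sum_{l\in\mathcal{N}_{p,t-t_p}}\gamma_{k,l}(t)\ge\alpha(p,t).$$ Then the contraction rate $\rho$ of the system satisfies $$\rho\le\limsup_{p\to+\infty}\ \prod_{p'=1}^{p}\left(1-\prod_{t=t_{p'}}^{t_{p'+1}-1}\alpha(p',t)\right)^{1/t_{p+1}}.$$
   Context: $\mathbb{N}$ includes $0$. A row-stochastic matrix has nonnegative entries and every row sums to $1$. The state components $x_k$ are real valued. Communication graph at time $t$: the directed graph $\mathcal{A}(t)=\{(k,l)\in\mathcal{N}\times\mathcal{N}:\gamma_{k,l}(t)>0\}$. Neighbors: for a graph $\mathcal{A}\subseteq\mathcal{N}\times\mathcal{N}$ and nonempty $\mathcal{L}\subseteq\mathcal{N}$, $\mathrm{Neighbors}(\mathcal{L},\mathcal{A})$ is the set of $k\in\mathcal{N}\setminus\mathcal{L}$ for which there is $l\in\mathcal{L}$ with $(k,l)\in\mathcal{A}$. Sequential connectivity: a finite sequence of graphs $\mathcal{A}_1,\dots,\mathcal{A}_S$ on $\mathcal{N}$ is sequentially connected if there are a node $k\in\mathcal{N}$ and sets $\mathcal{N}_0=\{k\}$, $\mathcal{N}_s\subseteq\mathcal{N}_{s-1}\cup\mathrm{Neighbors}(\mathcal{N}_{s-1},\mathcal{A}_s)$ for $s=1,\dots,S$, with $\mathcal{N}_S=\mathcal{N}$. $T$-sequential connectivity: an infinite sequence of graphs $\mathcal{A}(t)$, $t\in\mathbb{N}$, is $T$-sequentially connected if there is a strictly increasing integer sequence $(t_p)_{p\in\mathbb{N}}$ in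 $\mathbb{N}$ with $\limsup_{p\to+\infty}(t_{p+1}-t_p)\le T$ such that each finite sequence $\mathcal{A}(t_p),\dots,\mathcal{A}(t_{p+1}-1)$ is sequentially connected. Diameter: $\Delta(t)=\Delta(x(t))=\sup_{k\in\mathcal{N}}x_k(t)-\inf_{k\in\mathcal{N}}x_k(t)$. Contraction rate: $\rho=\sup_{x(0)}\limsup_{t\to+\infty}\left(\Delta(t)/\Delta(0)\right)^{1/t}\in[0,+\infty]$, the supremum being over initial states for which the ratio is meaningful, i.e. $0<\Delta(0)<+\infty$ (the supremum of the empty set being $0$). *)

theory Defs
  imports "HOL-Analysis.Analysis" "HOL-Library.FuncSet"
begin

definition row_stochastic :: "'a set \<Rightarrow> ('a \<Rightarrow> 'a \<Rightarrow> real) \<Rightarrow> bool" where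
  "row_stochastic N M \<longleftrightarrow>
     (\<forall>k\<in>N. (\<forall>l\<in>N. 0 \<le> M k l) \<and> (M k has_sum 1) N)"

definition comm_graph ::
    "'a set \<Rightarrow> (nat \<Rightarrow> 'a \<Rightarrow> 'a \<Rightarrow> real) \<Rightarrow> nat \<Rightarrow> ('a \<times> 'a) set" where
  "comm_graph N \<gamma> t = {(k, l) \<in> N \<times> N. \<gamma> t k l > 0}"

definition Neighbors :: "'a set \<Rightarrow> 'a set \<Rightarrow> ('a \<times> 'a) set \<Rightarrow> 'a set" where
  "Neighbors N L A = {k \<in> N - L. \<exists>l\<in>L. (k, l) \<in> A}"

(* The finite sequence of graphs is the list As, so As ! s is the graph leading from
   NN s to NN (Suc s). Values of NN beyond length As are irrelevant. *)
definition connecting_sets ::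
    "'a set \<Rightarrow> ('a \<times> 'a) set list \<Rightarrow> (nat \<Rightarrow> 'a set) \<Rightarrow> bool" where
  "connecting_sets N As NN \<longleftrightarrow>
     (\<exists>k\<in>N. NN 0 = {k}) \<and>
     (\<forall>s<length As. NN (Suc s) \<subseteq> NN s \<union> Neighbors N (NN s) (As ! s)) \<and>
     NN (length As) = N"

definition sequentially_connected :: "'a set \<Rightarrow> ('a \<times> 'a) set list \<Rightarrow> bool" where
  "sequentially_connected N As \<longleftrightarrow> (\<exists>NN. connecting_sets N As NN)"

definition connection_times ::
    "'a set \<Rightarrow> (nat \<Rightarrow> ('a \<times> 'a) set) \<Rightarrow> nat \<Rightarrow> (nat \<Rightarrow> nat) \<Rightarrow> bool" where
  "connection_times N A T \<tau> \<longleftrightarrow>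
     strict_mono \<tau> \<and>
     limsup (\<lambda>p. ereal (real (\<tau> (Suc p)) - real (\<tau> p))) \<le> ereal (real T) \<and>
     (\<forall>p. sequentially_connected N (map A [\<tau> p..<\<tau> (Suc p)]))"

definition T_sequentially_connected ::
    "'a set \<Rightarrow> (nat \<Rightarrow> ('a \<times> 'a) set) \<Rightarrow> nat \<Rightarrow> bool" where
  "T_sequentially_connected N A T \<longleftrightarrow> (\<exists>\<tau>. connection_times N A T \<tau>)"

(* The infinite sum converges for k in N whenever the initial state is bounded on N, and
   contraction_rate uses no other initial states. Values outside N play no role. *)
primrec trajectory ::
    "'a set \<Rightarrow> (nat \<Rightarrow> 'a \<Rightarrow> 'a \<Rightarrow> real) \<Rightarrow> ('a \<Rightarrow> real) \<Rightarrow> nat \<Rightarrow> 'a \<Rightarrow> real" where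
  "trajectory N \<gamma> x0 0 = x0"
| "trajectory N \<gamma> x0 (Suc t) = (\<lambda>k. \<Sum>\<^sub>\<infinity>l\<in>N. \<gamma> t k l * trajectory N \<gamma> x0 t l)"

(* For nonempty N the difference is never of the ambiguous form \<infinity> - \<infinity>, and it is nonnegative. *)
definition diameter_on :: "'a set \<Rightarrow> ('a \<Rightarrow> real) \<Rightarrow> ennreal" where
  "diameter_on N x = e2ennreal ((SUP k\<in>N. ereal (x k)) - (INF k\<in>N. ereal (x k)))"

definition ennreal_nth_root :: "nat \<Rightarrow> ennreal \<Rightarrow> ennreal" where
  "ennreal_nth_root n a = (if a = \<infinity> then \<infinity> else ennreal (enn2real a powr (1 / real n)))"

(* In ennreal the supremum of the empty set is 0. *)
definition contraction_rate :: "'a set \<Rightarrow> (nat \<Rightarrow> 'a \<Rightarrow> 'a \<Rightarrow> real) \<Rightarrow> ennreal" where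
  "contraction_rate N \<gamma> =
     (SUP x0\<in>{x0. 0 < diameter_on N x0 \<and> diameter_on N x0 < \<infinity>}.
        limsup (\<lambda>t. ennreal_nth_root t
          (diameter_on N (trajectory N \<gamma> x0 t) / diameter_on N (trajectory N \<gamma> x0 0))))"

definition block_times :: "(nat \<Rightarrow> nat) \<Rightarrow> (nat \<times> nat) set" where
  "block_times \<tau> = {(p, t). t \<in> {\<tau> p..<\<tau> (Suc p)}}"

end

theory Submission
  imports Defs
begin

text \<open>
  Let \<open>c\<close> be the state, at the start of a block, of the node the block starts from, and let all
  states lie in \<open>[m, M]\<close>. Along the block the nodes of \<open>NN p s\<close> lie above \<open>m + A (c - m)\<close> and below
  \<open>M - A (M - c)\<close>, where \<open>A\<close> is the product of the \<open>\<alpha>\<close>'s met so far, so the whole block shrinks the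
  enclosing interval by the factor \<open>1 - A\<close>. Between consecutive block ends, the exponent \<open>1 / t\<close> may
  be replaced by \<open>1 / \<tau> (Suc p)\<close> at a cost of at most \<open>T / t\<close>.
\<close>

section \<open>Bounds for infinite weighted means\<close>

text \<open>A divergent infinite sum takes the default value 0, so every estimate of the dynamics
  first needs convergence. The terms are dominated by a constant multiple of the summable
  weights.\<close>

lemma weighted_mean_summable:
  fixes w x :: "'a \<Rightarrow> real"
  assumes "w summable_on N" and "\<And>l. l \<in> N \<Longrightarrow> 0 \<le> w l"
    and "\<And>l. l \<in> N \<Longrightarrow> x l \<in> {m..M}"
  shows "(\<lambda>l. w l * x l) summable_on N"
proof -
  define C where "C = max \<bar>m\<bar> \<bar>M\<bar>"
  have "(\<lambda>l. C * w l) summable_on N"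
    using assms(1) by (rule summable_on_cmult_right)
  moreover have "norm (w l * x l) \<le> C * w l" if "l \<in> N" for l
  proof -
    have "\<bar>x l\<bar> \<le> C"
      using assms(3)[OF that] by (auto simp: C_def)
    then show ?thesis
      using assms(2)[OF that] by (simp add: abs_mult mult.commute[of C] mult_left_mono)
  qed
  ultimately have "(\<lambda>l. norm (w l * x l)) summable_on N"
    by (rule summable_on_comparison_test) auto
  then show ?thesis
    by (rule abs_summable_summable)
qed

text \<open>All the mass, which is 1, contributes at least the floor \<open>m\<close>, and the mass
  on \<open>S\<close>, at least \<open>a\<close>, contributes a further \<open>B\<close>. The
  comparison is made term by term, with the weights on \<open>S\<close> extended by zero to
  \<open>N\<close>. The upper bound \<open>M\<close> enters through convergence.\<close>

lemma weighted_mean_ge: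
  fixes w x :: "'a \<Rightarrow> real"
  assumes w: "(w has_sum 1) N" "\<And>l. l \<in> N \<Longrightarrow> 0 \<le> w l"
    and x: "\<And>l. l \<in> N \<Longrightarrow> x l \<in> {m..M}"
    and S: "S \<subseteq> N" "\<And>l. l \<in> S \<Longrightarrow> m + B \<le> x l" "0 \<le> B" "a \<le> (\<Sum>\<^sub>\<infinity>l\<in>S. w l)"
  shows "m + a * B \<le> (\<Sum>\<^sub>\<infinity>l\<in>N. w l * x l)"
proof -
  have "w summable_on S"
    using w(1) S(1) has_sum_imp_summable summable_on_subset_banach by blast
  then have "(w has_sum (\<Sum>\<^sub>\<infinity>l\<in>S. w l)) S"
    by simp
  then have "((\<lambda>l. if l \<in> S then w l else 0) has_sum (\<Sum>\<^sub>\<infinity>l\<in>S. w l)) N"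
    by (subst has_sum_cong_neutral[where T = S and g = w]) (use S(1) in auto)
  then have "((\<lambda>l. m * w l + B * (if l \<in> S then w l else 0)) has_sum
      (m * 1 + B * (\<Sum>\<^sub>\<infinity>l\<in>S. w l))) N"
    by (intro has_sum_add has_sum_cmult_right w(1))
  moreover have "((\<lambda>l. w l * x l) has_sum (\<Sum>\<^sub>\<infinity>l\<in>N. w l * x l)) N"
    using weighted_mean_summable[OF has_sum_imp_summable[OF w(1)] w(2) x] by simp
  moreover have "m * w l + B * (if l \<in> S then w l else 0) \<le> w l * x l" if "l \<in> N" for l
  proof -
    have "m + B * (if l \<in> S then 1 else 0) \<le> x l"
      using x[OF that] S(2) by auto
    from mult_left_mono[OF this w(2)[OF that]] show ?thesis
      by (auto simp: algebra_simps)
  qed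
  ultimately have "m * 1 + B * (\<Sum>\<^sub>\<infinity>l\<in>S. w l) \<le> (\<Sum>\<^sub>\<infinity>l\<in>N. w l * x l)"
    by (rule has_sum_mono)
  with mult_left_mono[OF S(4,3)] show ?thesis
    by (simp add: mult.commute)
qed

text \<open>Reflection \<open>x\<close> to \<open>- x\<close> of the lower bound; the reflected
  states lie between \<open>- M\<close> and \<open>- m\<close>.\<close>

lemma weighted_mean_le:
  fixes w x :: "'a \<Rightarrow> real"
  assumes w: "(w has_sum 1) N" "\<And>l. l \<in> N \<Longrightarrow> 0 \<le> w l"
    and x: "\<And>l. l \<in> N \<Longrightarrow> x l \<in> {m..M}"
    and S: "S \<subseteq> N" "\<And>l. l \<in> S \<Longrightarrow> x l \<le> M - B" "0 \<le> B" "a \<le> (\<Sum>\<^sub>\<infinity>l\<in>S. w l)"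
  shows "(\<Sum>\<^sub>\<infinity>l\<in>N. w l * x l) \<le> M - a * B"
proof -
  have "- M + a * B \<le> (\<Sum>\<^sub>\<infinity>l\<in>N. w l * - x l)"
    by (rule weighted_mean_ge[OF w _ S(1) _ S(3,4), where M = "- m"]) (use x S(2) in force)+
  also have "\<dots> = - (\<Sum>\<^sub>\<infinity>l\<in>N. w l * x l)"
    by (simp add: infsum_uminus)
  finally show ?thesis by simp
qed

section \<open>Enclosing intervals along a block\<close>

lemma trajectory_step_in_interval:
  assumes \<gamma>: "row_stochastic N (\<gamma> t)"
    and x: "\<And>l. l \<in> N \<Longrightarrow> trajectory N \<gamma> x0 t l \<in> {m..M}" and "k \<in> N"
  shows "trajectory N \<gamma> x0 (Suc t) k \<in> {m..M}"
proof -
  have w: "(\<gamma> t k has_sum 1) N" "\<And>l. l \<in> N \<Longrightarrow> 0 \<le> \<gamma> t k l"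
    using \<gamma> \<open>k \<in> N\<close> by (auto simp: row_stochastic_def)
  \<comment> \<open>With an empty \<open>S\<close> there is no gain, and the two mean bounds reduce
    to the interval itself.\<close>
  show ?thesis
    using weighted_mean_ge[OF w x, where S = "{}" and a = 0 and B = 0]
      weighted_mean_le[OF w x, where S = "{}" and a = 0 and B = 0]
    by simp
qed

lemma trajectory_in_interval:
  assumes \<gamma>: "\<And>t. row_stochastic N (\<gamma> t)"
    and x: "\<And>l. l \<in> N \<Longrightarrow> trajectory N \<gamma> x0 t l \<in> {m..M}"
    and "t \<le> t'" and "k \<in> N"
  shows "trajectory N \<gamma> x0 t' k \<in> {m..M}"
  using \<open>t \<le> t'\<close> \<open>k \<in> N\<close>
proof (induction t' arbitrary: k rule: dec_induct)
  case (step n)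
  show ?case
    by (rule trajectory_step_in_interval) (fact \<gamma> step.IH step.prems)+
qed (rule x)

text \<open>States and weights are controlled on \<open>N\<close> only, so the block argument may
  use them on the connecting sets only after this.\<close>

lemma connecting_sets_subset:
  assumes "connecting_sets N As NN" and "s \<le> length As"
  shows "NN s \<subseteq> N"
  using assms(2)
proof (induction s)
  case (Suc s)
  have "NN (Suc s) \<subseteq> NN s \<union> Neighbors N (NN s) (As ! s)"
    using assms(1) Suc.prems by (simp add: connecting_sets_def)
  moreover have "Neighbors N (NN s) (As ! s) \<subseteq> N"
    by (auto simp: Neighbors_def)
  ultimately show ?case
    using Suc by auto
qed (use assms(1) in \<open>auto simp: connecting_sets_def\<close>)

text \<open>The last connecting set is \<open>N\<close>, so in the end both bounds hold at every
  node. With \<open>A\<close> the full product, the gains \<open>A (c - m)\<close> from below and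
  \<open>A (M - c)\<close> from above add up to \<open>A (M - m)\<close>, so the unknown value
  \<open>c\<close> drops out of the width.\<close>

lemma block_contraction:
  fixes \<gamma> :: "nat \<Rightarrow> 'a \<Rightarrow> 'a \<Rightarrow> real"
  assumes \<gamma>: "\<And>t. row_stochastic N (\<gamma> t)"
    and NN: "connecting_sets N As NN"
    and a01: "\<And>s. s < length As \<Longrightarrow> a s \<in> {0..1}"
    and a: "\<And>s k. s < length As \<Longrightarrow> k \<in> NN (Suc s) \<Longrightarrow>
      a s \<le> (\<Sum>\<^sub>\<infinity>l\<in>NN s. \<gamma> (t + s) k l)"
    and x: "\<And>l. l \<in> N \<Longrightarrow> trajectory N \<gamma> x0 t l \<in> {m..M}"
  shows "\<exists>m' M'. (\<forall>l\<in>N. trajectory N \<gamma> x0 (t + length As) l \<in> {m'..M'}) \<and>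
    M' - m' = (M - m) * (1 - (\<Prod>s<length As. a s))"
proof -
  obtain k0 where k0: "k0 \<in> N" "NN 0 = {k0}"
    using NN by (auto simp: connecting_sets_def)
  define c where "c = trajectory N \<gamma> x0 t k0"
  have c: "m \<le> c" "c \<le> M"
    using x[OF k0(1)] by (auto simp: c_def)
  have *: "trajectory N \<gamma> x0 (t + s) k \<in>
      {m + (\<Prod>j<s. a j) * (c - m)..M - (\<Prod>j<s. a j) * (M - c)}"
    if "s \<le> length As" "k \<in> NN s" for s k
    using that
  proof (induction s arbitrary: k)
    case 0
    then show ?case
      using k0 by (simp add: c_def)
  next
    case (Suc s)
    have s: "s < length As" "NN s \<subseteq> N" "k \<in> N"
      using Suc.prems connecting_sets_subset[OF NN, of s] connecting_sets_subset[OF NN, of "Suc s"]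
      by auto
    have w: "(\<gamma> (t + s) k has_sum 1) N" "\<And>l. l \<in> N \<Longrightarrow> 0 \<le> \<gamma> (t + s) k l"
      using \<gamma> \<open>k \<in> N\<close> by (auto simp: row_stochastic_def)
    \<comment> \<open>Nodes outside \<open>NN s\<close> may carry weight too; for them the original
      interval, which persists, is the available bound.\<close>
    have xs: "\<And>l. l \<in> N \<Longrightarrow> trajectory N \<gamma> x0 (t + s) l \<in> {m..M}"
      by (rule trajectory_in_interval[OF \<gamma> x]) auto
    have A: "0 \<le> (\<Prod>j<s. a j)"
      by (rule prod_nonneg) (use a01 s(1) in force)
    have IH: "l \<in> NN s \<Longrightarrow> trajectory N \<gamma> x0 (t + s) l \<in>
      {m + (\<Prod>j<s. a j) * (c - m)..M - (\<Prod>j<s. a j) * (M - c)}" for l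
      using Suc.IH s(1) by simp
    \<comment> \<open>Here \<open>S\<close> is \<open>NN s\<close>, which carries weight at least
      \<open>a s\<close>, and the gain \<open>B\<close> is the distance from \<open>m\<close> given
      by the induction hypothesis. The upper bound is symmetric.\<close>
    have "m + a s * ((\<Prod>j<s. a j) * (c - m)) \<le> trajectory N \<gamma> x0 (t + Suc s) k"
      using weighted_mean_ge[OF w xs s(2) _ _ a[OF s(1) Suc.prems(2)]] IH A c by simp
    moreover have "trajectory N \<gamma> x0 (t + Suc s) k \<le> M - a s * ((\<Prod>j<s. a j) * (M - c))"
      using weighted_mean_le[OF w xs s(2) _ _ a[OF s(1) Suc.prems(2)]] IH A c by simp
    ultimately show ?case
      by (simp add: mult_ac)
  qed
  have "NN (length As) = N"
    using NN by (simp add: connecting_sets_def)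
  then show ?thesis
    using *[of "length As"]
    by (intro exI[of _ "m + (\<Prod>j<length As. a j) * (c - m)"]
        exI[of _ "M - (\<Prod>j<length As. a j) * (M - c)"]) (simp add: algebra_simps)
qed

section \<open>Diameter and enclosing intervals\<close>

lemma diameter_on_le:
  assumes "N \<noteq> {}" and "\<And>l. l \<in> N \<Longrightarrow> x l \<in> {m..M}"
  shows "diameter_on N x \<le> ennreal (M - m)"
proof -
  have "(SUP k\<in>N. ereal (x k)) \<le> ereal M"
    by (rule SUP_least) (use assms(2) in force)
  moreover have "ereal m \<le> (INF k\<in>N. ereal (x k))"
    by (rule INF_greatest) (use assms(2) in force)
  ultimately have "(SUP k\<in>N. ereal (x k)) - (INF k\<in>N. ereal (x k)) \<le> ereal M - ereal m"
    by (rule ereal_minus_mono)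
  then have "diameter_on N x \<le> e2ennreal (ereal M - ereal m)"
    unfolding diameter_on_def by (rule e2ennreal_mono)
  then show ?thesis
    by simp
qed

text \<open>A real value at some node lies between infimum and supremum, so the only infinite cases
  left are those in which the difference is infinite. The interval obtained is the tightest one,
  hence the equality with its width.\<close>

lemma finite_diameter_onE:
  assumes "N \<noteq> {}" and "diameter_on N x < \<infinity>"
  obtains m M where "\<And>l. l \<in> N \<Longrightarrow> x l \<in> {m..M}"
    and "diameter_on N x = ennreal (M - m)"
proof -
  obtain k where k: "k \<in> N"
    using assms(1) by blast
  let ?S = "SUP k\<in>N. ereal (x k)" and ?I = "INF k\<in>N. ereal (x k)"
  have S: "ereal (x l) \<le> ?S" and I: "?I \<le> ereal (x l)" if "l \<in> N" for l
    using that by (auto intro: SUP_upper INF_lower)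
  have "?S - ?I \<noteq> \<infinity>"
    using assms(2) by (auto simp: diameter_on_def)
  with S[OF k] I[OF k] obtain M m where "?S = ereal M" "?I = ereal m"
    by (cases ?S; cases ?I) auto
  note SI = this
  show ?thesis
  proof (rule that)
    show "x l \<in> {m..M}" if "l \<in> N" for l
      using S[OF that] I[OF that] by (simp add: SI)
    show "diameter_on N x = ennreal (M - m)"
      by (simp add: diameter_on_def SI)
  qed
qed

text \<open>Blocks 1 to \<open>p\<close> are contracted in succession. The end points depend on the
  states at each block start, so the induction carries only the existence of an interval of the
  prescribed width.\<close>

lemma trajectory_at_block_end:
  fixes \<tau> :: "nat \<Rightarrow> nat"
  assumes \<gamma>: "\<And>t. row_stochastic N (\<gamma> t)"
    and NN: "\<And>p. connecting_sets N (map G [\<tau> p..<\<tau> (Suc p)]) (NN p)"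
    and \<alpha>01: "\<alpha> \<in> block_times \<tau> \<rightarrow> {0..1}"
    and \<alpha>: "\<And>p t k. (p, t) \<in> block_times \<tau> \<Longrightarrow> k \<in> N \<Longrightarrow> k \<in> NN p (t - \<tau> p + 1) \<Longrightarrow>
      (\<Sum>\<^sub>\<infinity>l\<in>NN p (t - \<tau> p). \<gamma> t k l) \<ge> \<alpha> (p, t)"
    and \<tau>: "strict_mono \<tau>"
    and x0: "\<And>l. l \<in> N \<Longrightarrow> x0 l \<in> {m..M}"
  shows "\<exists>m' M'. (\<forall>l\<in>N. trajectory N \<gamma> x0 (\<tau> (Suc p)) l \<in> {m'..M'}) \<and>
    M' - m' = (M - m) * (\<Prod>p'=1..p. 1 - (\<Prod>t\<in>{\<tau> p'..<\<tau> (Suc p')}. \<alpha> (p', t)))"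
proof (induction p)
  case 0
  \<comment> \<open>The product starts at index 1, so up to time \<open>\<tau> 1\<close> it is
    enough that the initial interval is preserved.\<close>
  have "trajectory N \<gamma> x0 (\<tau> (Suc 0)) l \<in> {m..M}" if "l \<in> N" for l
    by (rule trajectory_in_interval[OF \<gamma> _ le0 that]) (use x0 in simp)
  then show ?case by auto
next
  case (Suc p)
  let ?q = "Suc p"
  let ?n = "\<tau> (Suc ?q) - \<tau> ?q"
  let ?As = "map G [\<tau> ?q..<\<tau> (Suc ?q)]"
  have le: "\<tau> ?q \<le> \<tau> (Suc ?q)"
    using \<tau> by (simp add: strict_mono_less_eq)
  obtain m' M' where IH: "\<And>l. l \<in> N \<Longrightarrow> trajectory N \<gamma> x0 (\<tau> ?q) l \<in> {m'..M'}"
    and eq: "M' - m' = (M - m) * (\<Prod>p'=1..p. 1 - (\<Prod>t\<in>{\<tau> p'..<\<tau> (Suc p')}. \<alpha> (p', t)))"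
    using Suc by blast
  have bt: "(?q, \<tau> ?q + s) \<in> block_times \<tau>" if "s < ?n" for s
    using that by (auto simp: block_times_def)
  have "\<exists>m'' M''. (\<forall>l\<in>N. trajectory N \<gamma> x0 (\<tau> ?q + length ?As) l \<in> {m''..M''}) \<and>
    M'' - m'' = (M' - m') * (1 - (\<Prod>s<length ?As. \<alpha> (?q, \<tau> ?q + s)))"
  proof (rule block_contraction[OF \<gamma> NN _ _ IH])
    fix s k
    assume s: "s < length ?As"
    then show "\<alpha> (?q, \<tau> ?q + s) \<in> {0..1}"
      by (intro funcset_mem[OF \<alpha>01] bt) simp
    assume k: "k \<in> NN ?q (Suc s)"
    then have "k \<in> N"
      using connecting_sets_subset[OF NN, of "Suc s" ?q] s by auto
    with k s show "\<alpha> (?q, \<tau> ?q + s) \<le> (\<Sum>\<^sub>\<infinity>l\<in>NN ?q s. \<gamma> (\<tau> ?q + s) k l)"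
      using \<alpha>[OF bt[of s]] by simp
  qed
  then obtain m'' M'' where x: "\<forall>l\<in>N. trajectory N \<gamma> x0 (\<tau> ?q + length ?As) l \<in> {m''..M''}"
    and d: "M'' - m'' = (M' - m') * (1 - (\<Prod>s<length ?As. \<alpha> (?q, \<tau> ?q + s)))"
    by blast
  have "\<tau> ?q + length ?As = \<tau> (Suc ?q)"
    using le by simp
  moreover have "(\<Prod>s<length ?As. \<alpha> (?q, \<tau> ?q + s)) = (\<Prod>t\<in>{\<tau> ?q..<\<tau> (Suc ?q)}. \<alpha> (?q, t))"
    using le
    by (intro prod.reindex_bij_witness[where i = "\<lambda>t. t - \<tau> ?q" and j = "\<lambda>s. \<tau> ?q + s"]) auto
  moreover have "(\<Prod>p'=1..?q. f p') = (\<Prod>p'=1..p. f p') * f ?q" for f :: "nat \<Rightarrow> real"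
    by simp
  ultimately have "M'' - m'' =
      (M - m) * (\<Prod>p'=1..?q. 1 - (\<Prod>t\<in>{\<tau> p'..<\<tau> (Suc p')}. \<alpha> (p', t)))"
    and "\<tau> ?q + length ?As = \<tau> (Suc ?q)"
    by (simp_all only: d eq mult.assoc)
  with x show ?case by metis
qed

section \<open>Roots and times between block ends\<close>

text \<open>Weighted arithmetic-geometric mean inequality for \<open>a\<close> and 1 with weights
  \<open>r\<close> and \<open>1 - r\<close>. With \<open>r\<close> the ratio of a block end to a
  later time, \<open>1 - r\<close> is the price of changing the exponent.\<close>

lemma powr_le_affine:
  fixes a r :: real
  assumes "0 \<le> a" "a \<le> 1" "0 < r" "r \<le> 1"
  shows "a powr r \<le> a + (1 - r)"
proof (cases "a = 0")
  case False
  have "a powr r * 1 powr (1 - r) \<le> r * a + (1 - r) * 1"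
    using assms False by (intro Youngs_inequality_0) auto
  also have "\<dots> \<le> a + (1 - r)"
    using assms by (simp add: mult_left_le_one_le)
  finally show ?thesis by simp
qed (use assms in simp)

lemma ennreal_nth_root_mono:
  assumes "a \<le> ennreal b" "0 \<le> b"
  shows "ennreal_nth_root n a \<le> ennreal (b powr (1 / real n))"
proof -
  obtain c where "a = ennreal c" "0 \<le> c"
    using assms(1) by (cases a) (auto simp: top_unique)
  then show ?thesis
    using assms by (auto simp: ennreal_nth_root_def intro!: ennreal_leI powr_mono2)
qed

text \<open>Strict monotonicity gives \<open>p \<le> \<tau> p\<close>, so the indices with
  \<open>\<tau> p \<le> t\<close> are bounded by \<open>t\<close>; the greatest of them is the
  required one.\<close>

lemma strict_mono_nat_bracket:
  fixes \<tau> :: "nat \<Rightarrow> nat"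
  assumes "strict_mono \<tau>" and "\<tau> P \<le> t"
  obtains p where "P \<le> p" "\<tau> p \<le> t" "t < \<tau> (Suc p)"
proof -
  have bound: "p \<le> t" if "\<tau> p \<le> t" for p
    using strict_mono_imp_increasing[OF assms(1), of p] that by simp
  define p where "p = (GREATEST p. \<tau> p \<le> t)"
  have "\<tau> p \<le> t"
    unfolding p_def by (rule GreatestI_nat[where P = "\<lambda>p. \<tau> p \<le> t" and b = t and k = P]) (use assms(2) bound in auto)
  moreover have "P \<le> p"
    unfolding p_def by (rule Greatest_le_nat[where P = "\<lambda>p. \<tau> p \<le> t" and b = t]) (use assms(2) bound in auto)
  moreover have "t < \<tau> (Suc p)"
  proof (rule ccontr)
    assume "\<not> t < \<tau> (Suc p)"
    then have "Suc p \<le> p"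
      unfolding p_def by (intro Greatest_le_nat[where P = "\<lambda>p. \<tau> p \<le> t" and b = t]) (use bound in auto)
    then show False by simp
  qed
  ultimately show ?thesis using that by blast
qed

section \<open>The bound on the contraction rate\<close>

theorem theorem3:
  fixes N :: "'a set"
    and \<gamma> :: "nat \<Rightarrow> 'a \<Rightarrow> 'a \<Rightarrow> real"
    and T :: nat
    and \<tau> :: "nat \<Rightarrow> nat"
    and NN :: "nat \<Rightarrow> nat \<Rightarrow> 'a set"
    and \<alpha> :: "nat \<times> nat \<Rightarrow> real"
  assumes "N \<noteq> {}" and "countable N"
    and "\<And>t. row_stochastic N (\<gamma> t)"
    and "T > 0"
    and "T_sequentially_connected N (comm_graph N \<gamma>) T"
    and "connection_times N (comm_graph N \<gamma>) T \<tau>"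
    and "\<And>p. connecting_sets N (map (comm_graph N \<gamma>) [\<tau> p..<\<tau> (Suc p)]) (NN p)"
    and "\<alpha> \<in> block_times \<tau> \<rightarrow> {0..1}"
    and "\<And>p t k. (p, t) \<in> block_times \<tau> \<Longrightarrow> k \<in> N \<Longrightarrow> k \<in> NN p (t - \<tau> p + 1) \<Longrightarrow>
           (\<Sum>\<^sub>\<infinity>l\<in>NN p (t - \<tau> p). \<gamma> t k l) \<ge> \<alpha> (p, t)"
  shows "contraction_rate N \<gamma> \<le>
    limsup (\<lambda>p. ennreal (\<Prod>p'=1..p.
      (1 - (\<Prod>t\<in>{\<tau> p'..<\<tau> (Suc p')}. \<alpha> (p', t))) powr (1 / real (\<tau> (Suc p)))))"
proof -
  \<comment> \<open>\<open>b p\<close> is the contraction factor of block \<open>p\<close>, and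
    \<open>a p\<close> is the term whose limsup \<open>L\<close> is the claimed bound.\<close>
  define b where "b p = 1 - (\<Prod>t\<in>{\<tau> p..<\<tau> (Suc p)}. \<alpha> (p, t))" for p
  define a where "a p = (\<Prod>p'=1..p. b p' powr (1 / real (\<tau> (Suc p))))" for p
  define L where "L = limsup (\<lambda>p. ennreal (a p))"
  have \<tau>: "strict_mono \<tau>"
    and gap: "limsup (\<lambda>p. ereal (real (\<tau> (Suc p)) - real (\<tau> p))) \<le> ereal (real T)"
    using assms(6) by (auto simp: connection_times_def)
  have \<tau>_pos: "0 < \<tau> (Suc p)" for p
    using strict_monoD[OF \<tau>, of p "Suc p"] by simp
  have b01: "0 \<le> b p" "b p \<le> 1" for p
  proof -
    have "\<alpha> (p, t) \<in> {0..1}" if "t \<in> {\<tau> p..<\<tau> (Suc p)}" for t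
      by (rule funcset_mem[OF assms(8)]) (use that in \<open>simp add: block_times_def\<close>)
    then show "0 \<le> b p" "b p \<le> 1"
      by (auto simp: b_def intro!: prod_nonneg prod_le_1)
  qed
  have B01: "0 \<le> (\<Prod>p'=1..p. b p')" "(\<Prod>p'=1..p. b p') \<le> 1" for p
    using b01 by (auto intro!: prod_nonneg prod_le_1)
  have a_eq: "a p = (\<Prod>p'=1..p. b p') powr (1 / real (\<tau> (Suc p)))" for p
    unfolding a_def by (intro prod_powr_distrib[symmetric] b01)
  have a01: "0 \<le> a p" "a p \<le> 1" for p
    using B01[of p] by (simp_all add: a_eq powr_le1)
  \<comment> \<open>Finiteness of \<open>L\<close> is what makes
    \<open>L < L + ennreal (e / 2)\<close> strict below.\<close>
  have "L \<le> 1"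
    unfolding L_def using a01(2) by (intro Limsup_bounded) auto
  then have "L < \<infinity>"
    using le_less_trans by fastforce
  have "limsup (\<lambda>t. ennreal_nth_root t
      (diameter_on N (trajectory N \<gamma> x0 t) / diameter_on N (trajectory N \<gamma> x0 0))) \<le> L"
    if x0: "0 < diameter_on N x0" "diameter_on N x0 < \<infinity>" for x0
  proof -
    let ?f = "\<lambda>t. ennreal_nth_root t
      (diameter_on N (trajectory N \<gamma> x0 t) / diameter_on N (trajectory N \<gamma> x0 0))"
    obtain m M where mM: "\<And>l. l \<in> N \<Longrightarrow> x0 l \<in> {m..M}"
      and d: "diameter_on N x0 = ennreal (M - m)"
      using finite_diameter_onE[OF assms(1) x0(2)] by metis
    have "m < M"
      using x0(1) d by (simp add: ennreal_zero_less_divide)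
    \<comment> \<open>Any time past the end of block \<open>p\<close> keeps the interval reached
      there. The \<open>t\<close>-th root of the accumulated factor is \<open>a p\<close> raised to
      \<open>\<tau> (Suc p) / t\<close>, which the affine bound turns into an additive
      error.\<close>
    have f: "?f t \<le> ennreal (a p + real (t - \<tau> (Suc p)) / real t)" if t: "\<tau> (Suc p) \<le> t" for p t
    proof -
      have "\<exists>m' M'. (\<forall>l\<in>N. trajectory N \<gamma> x0 (\<tau> (Suc p)) l \<in> {m'..M'}) \<and>
          M' - m' = (M - m) * (\<Prod>p'=1..p. b p')"
        unfolding b_def by (rule trajectory_at_block_end) (fact assms \<tau> mM)+
      then obtain m' M' where x: "\<forall>l\<in>N. trajectory N \<gamma> x0 (\<tau> (Suc p)) l \<in> {m'..M'}"
        and eq: "M' - m' = (M - m) * (\<Prod>p'=1..p. b p')"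
        by blast
      have "diameter_on N (trajectory N \<gamma> x0 t) \<le> ennreal (M' - m')"
        by (intro diameter_on_le[OF assms(1)] trajectory_in_interval[OF assms(3) _ t])
          (use x in auto)
      then have "diameter_on N (trajectory N \<gamma> x0 t) / diameter_on N (trajectory N \<gamma> x0 0)
          \<le> ennreal (M' - m') / ennreal (M - m)"
        by (simp add: d divide_right_mono_ennreal)
      also have "\<dots> = ennreal (\<Prod>p'=1..p. b p')"
        using \<open>m < M\<close> B01(1)[of p] by (simp add: eq divide_ennreal)
      finally have "?f t \<le> ennreal ((\<Prod>p'=1..p. b p') powr (1 / real t))"
        by (rule ennreal_nth_root_mono) (rule B01)
      also have "(\<Prod>p'=1..p. b p') powr (1 / real t) = a p powr (real (\<tau> (Suc p)) / real t)"
        using \<tau>_pos[of p] by (simp add: a_eq powr_powr)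
      also have "\<dots> \<le> a p + (1 - real (\<tau> (Suc p)) / real t)"
        using \<tau>_pos[of p] t by (intro powr_le_affine a01) auto
      also have "1 - real (\<tau> (Suc p)) / real t = real (t - \<tau> (Suc p)) / real t"
        using \<tau>_pos[of p] t by (simp add: field_simps of_nat_diff)
      finally show ?thesis
        by (simp add: ennreal_leI)
    qed
    show "limsup ?f \<le> L"
    \<comment> \<open>One half of \<open>e\<close> covers the limsup of \<open>a\<close>, the other
      half the change of exponent.\<close>
    proof (rule ennreal_le_epsilon)
      fix e :: real
      assume "0 < e"
      have "L < L + ennreal (e / 2)"
        using \<open>L < \<infinity>\<close> \<open>0 < e\<close> by (simp add: ennreal_add_left_cancel_less)
      then have "\<forall>\<^sub>F p in sequentially. ennreal (a p) < L + ennreal (e / 2)"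
        unfolding L_def by (rule Limsup_lessD)
      \<comment> \<open>The slack 1 gives a strict bound, which then holds eventually. It is
        absorbed later, since times within a block stay at least 1 below its end.\<close>
      moreover have "limsup (\<lambda>p. ereal (real (\<tau> (Suc p)) - real (\<tau> p))) < ereal (real T + 1)"
        by (rule le_less_trans[OF gap]) simp
      then have "\<forall>\<^sub>F p in sequentially. ereal (real (\<tau> (Suc p)) - real (\<tau> p)) < ereal (real T + 1)"
        by (rule Limsup_lessD)
      ultimately have "\<forall>\<^sub>F p in sequentially. ennreal (a p) < L + ennreal (e / 2) \<and>
          real (\<tau> (Suc p)) - real (\<tau> p) < real T + 1"
        by eventually_elim simp
      then obtain P where P: "\<And>p. P \<le> p \<Longrightarrow> ennreal (a p) < L + ennreal (e / 2)"
          "\<And>p. P \<le> p \<Longrightarrow> real (\<tau> (Suc p)) - real (\<tau> p) < real T + 1"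
        by (auto simp: eventually_sequentially)
      have "(\<lambda>t. real T / real t) \<longlonglongrightarrow> 0"
        by (rule lim_const_over_n)
      then have "\<forall>\<^sub>F t in sequentially. real T / real t < e / 2"
        by (rule order_tendstoD) (use \<open>0 < e\<close> in simp)
      moreover have "\<forall>\<^sub>F t in sequentially. \<tau> (Suc P) \<le> t"
        by (rule eventually_ge_at_top)
      ultimately have "\<forall>\<^sub>F t in sequentially. ?f t \<le> L + ennreal e"
      proof eventually_elim
        case (elim t)
        obtain q where q: "Suc P \<le> q" "\<tau> q \<le> t" "t < \<tau> (Suc q)"
          using strict_mono_nat_bracket[OF \<tau> elim(2)] .
        \<comment> \<open>The time \<open>t\<close> lies in block \<open>q\<close>, whose
          contraction is incomplete; the last completed block is \<open>p = q - 1\<close>, ending at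
          \<open>\<tau> q\<close>, the exponent in \<open>a p\<close>. Starting from
          \<open>\<tau> (Suc P)\<close> makes \<open>q\<close> positive and \<open>p\<close> at
          least \<open>P\<close>.\<close>
        then obtain p where p: "q = Suc p" "P \<le> p"
          by (cases q) auto
        have "real (t - \<tau> q) \<le> real T"
          using P(2)[of q] q p by linarith
        then have "real (t - \<tau> (Suc p)) / real t \<le> e / 2"
          using elim(1) p(1) by (smt (verit) divide_right_mono of_nat_0_le_iff)
        then have "?f t \<le> ennreal (a p + e / 2)"
          using f[of p t] q(2) p(1) by (meson add_left_mono ennreal_leI order_trans)
        also have "\<dots> = ennreal (a p) + ennreal (e / 2)"
          using a01 \<open>0 < e\<close> by simp
        also have "\<dots> \<le> L + ennreal (e / 2) + ennreal (e / 2)"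
          using P(1)[OF p(2)] by (intro add_right_mono) simp
        also have "\<dots> = L + ennreal e"
          using \<open>0 < e\<close> by (simp add: add.assoc flip: ennreal_plus)
        finally show ?case .
      qed
      then show "limsup ?f \<le> L + ennreal e"
        by (rule Limsup_bounded)
    qed
  qed
  then show ?thesis
    unfolding contraction_rate_def L_def a_def b_def by (intro SUP_least) auto
qed

end
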